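(* Let $D$ be an integral domain and $S$ a multiplicatively closed subset of $D$ with the following property: for every prime ideal $P$ of $D$ with $P\cap S\neq\emptyset$, one has $Q\cap S\neq\emptyset$ for each nonzero prime ideal $Q\subseteq P$ of $D$. Then $R=D+XD_S[X]$ is a Hilbert domain if and only if $D$ and $D_S$ are Hilbert domains.
   Context: All rings are commutative with unity. $D_S$ denotes the localization of $D$ at the multiplicatively closed set $S$, where $0\notin S$, so that $D\subset D_S$; $D+XD_S[X]=\{a_0+\sum_{i\ge 1} a_iX^i \mid a_0\in D,\ a_i\in D_S\}$ is a subring of the polynomial ring $D_S[X]$. A commutative ring is called a Hilbert ring if every prime ideal is an intersection of maximal ideals; a Hilbert domain is an integral domain that is a Hilbert ring. *)

theory Defs
  imports "HOL-Algebra.Algebra" "HOL-Algebra.Algebraic_Closure_Type"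
begin

definition hilbert_ring :: "('a, 'b) ring_scheme \<Rightarrow> bool" where
  "hilbert_ring R \<longleftrightarrow>
     cring R \<and>
     (\<forall>P. primeideal P R \<longrightarrow>
        (\<exists>\<M>. \<M> \<noteq> {} \<and> (\<forall>M\<in>\<M>. maximalideal M R) \<and> P = \<Inter>\<M>))"

definition hilbert_domain :: "('a, 'b) ring_scheme \<Rightarrow> bool" where
  "hilbert_domain R \<longleftrightarrow> domain R \<and> hilbert_ring R"

text \<open>
  The domain \<open>D\<close> is the type \<open>'a\<close>. For a nonempty multiplicatively closed set \<open>S\<close> with
  \<open>0 \<notin> S\<close>, the localization \<open>D\<^sub>S\<close> is realized as the ring of all fractions \<open>a / s\<close> with \<open>s \<in> S\<close>
  inside the field of fractions of \<open>D\<close>. The inclusion of \<open>D\<close> into \<open>D\<^sub>S\<close> is \<open>to_fract\<close>.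
  (Since \<open>Fract a 0 = 0\<close>, the definition is meaningful only when \<open>0 \<notin> S\<close>.)
\<close>

definition localization :: "'a::idom set \<Rightarrow> 'a fract ring" where
  "localization S = ring_of_type_algebra \<lparr>carrier := {Fract a s | a s. s \<in> S}\<rparr>"

text \<open>\<open>D + X D\<^sub>S[X]\<close> as a subring of the polynomial ring over the field of fractions.\<close>

definition D_plus_X_localization_poly :: "'a::idom set \<Rightarrow> 'a fract poly ring" where
  "D_plus_X_localization_poly S = ring_of_type_algebra
     \<lparr>carrier := {p. poly.coeff p 0 \<in> range to_fract \<and>
                     (\<forall>i\<ge>1. poly.coeff p i \<in> carrier (localization S))}\<rparr>"

end

theory Submission
  imports Defs
begin

text \<open>
  A ring is Hilbert iff each of its Goldman primes is maximal, where a prime \<open>N\<close> is Goldman if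
  for some \<open>f \<notin> N\<close> every strictly larger ideal contains a power of \<open>f\<close>; in one direction Zorn's
  lemma extends a prime avoiding \<open>f\<close> to a Goldman prime.

  Setting \<open>X = 0\<close> and \<open>X = 1\<close> maps \<open>R\<close> onto \<open>D\<close> and onto \<open>D\<^sub>S\<close>, so both are Hilbert if \<open>R\<close> is.
  Conversely, \<open>I = X D\<^sub>S[X]\<close> is a common ideal of \<open>R\<close> and \<open>B = D\<^sub>S[X]\<close>. A Goldman prime of \<open>R\<close>
  containing \<open>I\<close> is one of \<open>R/I = D\<close>; any other one extends to a Goldman prime of \<open>B\<close>, and
  maximality descends because \<open>I\<close> is comaximal with the extension. That \<open>B\<close> is Hilbert is the general
  Nullstellensatz: if \<open>N\<close> is a Goldman prime of \<open>A[X]\<close>, then \<open>A[X]/N\<close> is algebraic over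
  \<open>A/(N \<inter> A)\<close>, which makes \<open>N \<inter> A\<close> Goldman, hence maximal, and then so is \<open>N\<close>.
\<close>

section \<open>Subrings, ideals and Goldman primes as subsets of a type-class ring\<close>

definition ring_on :: "'r::comm_ring_1 set \<Rightarrow> 'r ring" where
  "ring_on A = ring_of_type_algebra \<lparr>carrier := A\<rparr>"

definition subring_set :: "'r::comm_ring_1 set \<Rightarrow> bool" where
  "subring_set A \<longleftrightarrow> 1 \<in> A \<and> (\<forall>x\<in>A. \<forall>y\<in>A. x - y \<in> A \<and> x * y \<in> A)"

definition ideal_set :: "'r::comm_ring_1 set \<Rightarrow> 'r set \<Rightarrow> bool" where
  "ideal_set A I \<longleftrightarrow> I \<subseteq> A \<and> 0 \<in> I \<and> (\<forall>x\<in>I. \<forall>y\<in>I. x + y \<in> I) \<and> (\<forall>a\<in>A. \<forall>x\<in>I. a * x \<in> I)"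

definition prime_set :: "'r::comm_ring_1 set \<Rightarrow> 'r set \<Rightarrow> bool" where
  "prime_set A P \<longleftrightarrow> ideal_set A P \<and> 1 \<notin> P \<and> (\<forall>x\<in>A. \<forall>y\<in>A. x * y \<in> P \<longrightarrow> x \<in> P \<or> y \<in> P)"

text \<open>This says that \<open>A / M\<close> is a field. It speaks of elements instead of larger
  ideals, so that maximality can be moved along homomorphisms and ring extensions by computing with
  inverses.\<close>

definition maximal_set :: "'r::comm_ring_1 set \<Rightarrow> 'r set \<Rightarrow> bool" where
  "maximal_set A M \<longleftrightarrow> ideal_set A M \<and> 1 \<notin> M \<and> (\<forall>x\<in>A - M. \<exists>y\<in>A. 1 - x * y \<in> M)"

text \<open>Equivalently, the domain \<open>A / N\<close> becomes a field once \<open>f\<close> is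
  inverted. Testing the ideals \<open>N + x A\<close> suffices, since every ideal strictly above
  \<open>N\<close> contains one of them.\<close>

definition goldman_set :: "'r::comm_ring_1 set \<Rightarrow> 'r set \<Rightarrow> 'r \<Rightarrow> bool" where
  "goldman_set A N f \<longleftrightarrow> prime_set A N \<and> f \<in> A - N \<and> (\<forall>x\<in>A - N. \<exists>y\<in>A. \<exists>k. f ^ k - x * y \<in> N)"

definition hilbert_set :: "'r::comm_ring_1 set \<Rightarrow> bool" where
  "hilbert_set A \<longleftrightarrow> (\<forall>N f. goldman_set A N f \<longrightarrow> maximal_set A N)"

lemma hilbert_setD: "hilbert_set A \<Longrightarrow> goldman_set A N f \<Longrightarrow> maximal_set A N"
  by (auto simp: hilbert_set_def)

lemma ring_on_simps [simp]:
  "carrier (ring_on A) = A" "x \<otimes>\<^bsub>ring_on A\<^esub> y = x * y" "x \<oplus>\<^bsub>ring_on A\<^esub> y = x + y"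
  "\<one>\<^bsub>ring_on A\<^esub> = 1" "\<zero>\<^bsub>ring_on A\<^esub> = 0"
  by (simp_all add: ring_on_def ring_of_type_algebra_def)

context
  fixes A :: "'r::comm_ring_1 set"
  assumes A: "subring_set A"
begin

lemma subring_one: "1 \<in> A"
  and subring_diff: "x \<in> A \<Longrightarrow> y \<in> A \<Longrightarrow> x - y \<in> A"
  and subring_mult: "x \<in> A \<Longrightarrow> y \<in> A \<Longrightarrow> x * y \<in> A"
  using A by (auto simp: subring_set_def)

lemma subring_zero: "0 \<in> A"
  using subring_diff[OF subring_one subring_one] by simp

lemma subring_uminus: "x \<in> A \<Longrightarrow> - x \<in> A"
  using subring_diff[OF subring_zero, of x] by simp

lemma subring_add: "x \<in> A \<Longrightarrow> y \<in> A \<Longrightarrow> x + y \<in> A"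
  using subring_diff[of x "- y"] subring_uminus by simp

lemma subring_power: "x \<in> A \<Longrightarrow> x ^ k \<in> A"
  by (induction k) (auto intro: subring_one subring_mult)

lemma subring_sum: "(\<And>i. i \<in> J \<Longrightarrow> g i \<in> A) \<Longrightarrow> sum g J \<in> A"
  by (induction J rule: infinite_finite_induct) (auto intro: subring_zero subring_add)

lemma ideal_subset: "ideal_set A I \<Longrightarrow> x \<in> I \<Longrightarrow> x \<in> A"
  and ideal_zero: "ideal_set A I \<Longrightarrow> 0 \<in> I"
  and ideal_add: "ideal_set A I \<Longrightarrow> x \<in> I \<Longrightarrow> y \<in> I \<Longrightarrow> x + y \<in> I"
  and ideal_mult: "ideal_set A I \<Longrightarrow> a \<in> A \<Longrightarrow> x \<in> I \<Longrightarrow> a * x \<in> I"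
  by (auto simp: ideal_set_def)

lemma ideal_mult_right: "ideal_set A I \<Longrightarrow> a \<in> A \<Longrightarrow> x \<in> I \<Longrightarrow> x * a \<in> I"
  using ideal_mult[of I a x] by (simp add: mult.commute)

lemma ideal_uminus: "ideal_set A I \<Longrightarrow> x \<in> I \<Longrightarrow> - x \<in> I"
  using ideal_mult[of I "- 1" x] subring_uminus[OF subring_one] by simp

lemma ideal_diff: "ideal_set A I \<Longrightarrow> x \<in> I \<Longrightarrow> y \<in> I \<Longrightarrow> x - y \<in> I"
  using ideal_uminus[of I y] ideal_add[of I x "- y"] by simp

lemma ideal_sum: "ideal_set A I \<Longrightarrow> (\<And>j. j \<in> J \<Longrightarrow> g j \<in> I) \<Longrightarrow> sum g J \<in> I"
  by (induction J rule: infinite_finite_induct) (auto intro: ideal_zero ideal_add)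

lemma cring_ring_on: "cring (ring_on A)"
proof (rule cringI)
  show "abelian_group (ring_on A)"
    by (rule abelian_groupI)
       (auto simp: subring_add subring_zero add_ac intro: bexI[of _ "- _"] subring_uminus)
  show "comm_monoid (ring_on A)"
    by (rule comm_monoidI) (auto simp: subring_mult subring_one mult_ac)
qed (auto simp: algebra_simps)

lemma a_inv_ring_on: "x \<in> A \<Longrightarrow> \<ominus>\<^bsub>ring_on A\<^esub> x = - x"
proof -
  assume x: "x \<in> A"
  interpret cring "ring_on A" by (rule cring_ring_on)
  show ?thesis
    using minus_equality[of "- x" x] x subring_uminus by simp
qed

lemma ideal_ring_on: "ideal I (ring_on A) \<longleftrightarrow> ideal_set A I"
proof
  assume "ideal I (ring_on A)"
  then interpret ideal I "ring_on A" .
  show "ideal_set A I"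
    using a_subset I_l_closed additive_subgroup.a_closed[OF additive_subgroup_axioms]
      additive_subgroup.zero_closed[OF additive_subgroup_axioms]
    by (auto simp: ideal_set_def)
next
  assume I: "ideal_set A I"
  have "ring (ring_on A)"
    using cring_ring_on by (rule cring.axioms)
  then show "ideal I (ring_on A)"
  proof (rule idealI)
    show "subgroup I (add_monoid (ring_on A))"
    proof (rule subgroup.intro)
      show "inv\<^bsub>add_monoid (ring_on A)\<^esub> x \<in> I" if "x \<in> I" for x
        using a_inv_ring_on[OF ideal_subset[OF I that]] ideal_uminus[OF I that]
        by (simp add: a_inv_def)
    qed (simp_all add: subsetI ideal_subset[OF I] ideal_zero[OF I] ideal_add[OF I])
  qed (simp_all add: ideal_mult[OF I] ideal_mult_right[OF I])
qed

lemma ideal_one_iff: "ideal_set A I \<Longrightarrow> 1 \<in> I \<longleftrightarrow> I = A"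
  using subring_one by (force simp: ideal_set_def)

lemma primeideal_ring_on: "primeideal P (ring_on A) \<longleftrightarrow> prime_set A P"
proof
  assume "primeideal P (ring_on A)"
  then interpret primeideal P "ring_on A" .
  have "ideal_set A P"
    using ideal_ring_on is_ideal by blast
  then show "prime_set A P"
    using I_prime I_notcarr ideal_one_iff by (auto simp: prime_set_def)
next
  assume P: "prime_set A P"
  then have "ideal_set A P" by (simp add: prime_set_def)
  then show "primeideal P (ring_on A)"
    using P cring_ring_on ideal_ring_on ideal_one_iff
    by (intro primeidealI) (auto simp: prime_set_def)
qed

text \<open>The set is \<open>I + x A\<close>, the ideal generated by \<open>I\<close> and
  \<open>x\<close>.\<close>

lemma ideal_extend:
  assumes I: "ideal_set A I" and x: "x \<in> A"
  shows "ideal_set A {t \<in> A. \<exists>y\<in>A. t - x * y \<in> I}"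
proof -
  have "\<exists>y\<in>A. t - x * y \<in> I" if "t \<in> I" for t
    using that subring_zero by (auto intro!: bexI[of _ 0])
  moreover have "\<exists>y\<in>A. s + t - x * y \<in> I"
    if "y \<in> A" "s - x * y \<in> I" "z \<in> A" "t - x * z \<in> I" for s t y z
  proof (rule bexI[of _ "y + z"])
    have "(s - x * y) + (t - x * z) \<in> I"
      using that ideal_add[OF I] by blast
    then show "s + t - x * (y + z) \<in> I"
      by (simp add: algebra_simps)
  qed (use that subring_add in auto)
  moreover have "\<exists>y\<in>A. a * t - x * y \<in> I" if "a \<in> A" "y \<in> A" "t - x * y \<in> I" for a t y
  proof (rule bexI[of _ "a * y"])
    have "a * (t - x * y) \<in> I"
      using that ideal_mult[OF I] by blast
    then show "a * t - x * (a * y) \<in> I"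
      by (simp add: algebra_simps)
  qed (use that subring_mult in auto)
  moreover have "\<exists>y\<in>A. - (x * y) \<in> I"
    using ideal_zero[OF I] subring_zero by (auto intro!: bexI[of _ 0])
  ultimately show ?thesis
    unfolding ideal_set_def using subring_add subring_mult subring_zero by auto
qed

lemma subset_ideal_extend:
  assumes "ideal_set A I"
  shows "I \<subseteq> {t \<in> A. \<exists>y\<in>A. t - x * y \<in> I}"
  using assms subring_zero by (auto simp: ideal_set_def intro!: bexI[of _ 0])

lemma mem_ideal_extend:
  assumes "ideal_set A I" "x \<in> A"
  shows "x \<in> {t \<in> A. \<exists>y\<in>A. t - x * y \<in> I}"
  using assms subring_one by (auto simp: ideal_set_def intro!: bexI[of _ 1])

text \<open>If \<open>M\<close> is maximal, then \<open>M + x A\<close> is the whole ring.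
  Conversely, an ideal that contains \<open>M\<close> and some \<open>x\<close> outside
  \<open>M\<close> contains \<open>1 = (1 - x y) + y x\<close>.\<close>

lemma maximalideal_ring_on: "maximalideal M (ring_on A) \<longleftrightarrow> maximal_set A M"
proof
  assume "maximalideal M (ring_on A)"
  then interpret maximalideal M "ring_on A" .
  have M: "ideal_set A M"
    using ideal_ring_on is_ideal by blast
  have "\<exists>y\<in>A. 1 - x * y \<in> M" if x: "x \<in> A - M" for x
  proof -
    have "{t \<in> A. \<exists>y\<in>A. t - x * y \<in> M} = A"
      using I_maximal[of "{t \<in> A. \<exists>y\<in>A. t - x * y \<in> M}"] ideal_extend[OF M, of x] x
        subset_ideal_extend[OF M, of x] mem_ideal_extend[OF M, of x] ideal_ring_on
      by auto
    then show ?thesis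
      using subring_one by blast
  qed
  then show "maximal_set A M"
    using M I_notcarr ideal_one_iff by (auto simp: maximal_set_def)
next
  assume M: "maximal_set A M"
  then have M': "ideal_set A M" by (simp add: maximal_set_def)
  show "maximalideal M (ring_on A)"
  proof (rule maximalidealI)
    fix J assume J: "ideal J (ring_on A)" "M \<subseteq> J" "J \<subseteq> carrier (ring_on A)"
    show "J = M \<or> J = carrier (ring_on A)"
    proof (cases "J = M")
      case False
      then obtain x where x: "x \<in> J" "x \<notin> M" using J by blast
      then obtain y where y: "y \<in> A" "1 - x * y \<in> M"
        using M J by (force simp: maximal_set_def)
      have J': "ideal_set A J" using J ideal_ring_on by blast
      have "(1 - x * y) + y * x \<in> J"
        using J(2) x(1) y ideal_add[OF J'] ideal_mult[OF J'] by blast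
      then show ?thesis
        using ideal_one_iff[OF J'] by (simp add: mult.commute)
    qed simp
  qed (use M M' ideal_ring_on ideal_one_iff in \<open>auto simp: maximal_set_def\<close>)
qed

text \<open>Zorn's lemma gives \<open>N\<close> maximal among the ideals above \<open>P\<close> that
  contain no power of \<open>f\<close>. Maximality is already the Goldman condition, and primality
  follows from it.\<close>

lemma goldman_set_exists:
  assumes P: "prime_set A P" and f: "f \<in> A - P"
  obtains N where "goldman_set A N f" "P \<subseteq> N"
proof -
  define F where "F = {I. ideal_set A I \<and> P \<subseteq> I \<and> (\<forall>k. f ^ k \<notin> I)}"
  have fP: "f ^ k \<notin> P" for k
    using P f subring_power by (induction k) (auto simp: prime_set_def)
  have "\<exists>N\<in>F. \<forall>J\<in>F. N \<subseteq> J \<longrightarrow> J = N"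
  proof (rule subset_Zorn_nonempty)
    show "F \<noteq> {}"
      using P fP by (auto simp: F_def prime_set_def)
    fix C assume C: "C \<noteq> {}" "subset.chain F C"
    have CF: "C \<subseteq> F" and ch: "\<And>J K. J \<in> C \<Longrightarrow> K \<in> C \<Longrightarrow> J \<subseteq> K \<or> K \<subseteq> J"
      using C(2) by (auto simp: subset_chain_def)
    have "ideal_set A (\<Union>C)"
      unfolding ideal_set_def
    proof (intro conjI ballI)
      show "\<Union>C \<subseteq> A" "0 \<in> \<Union>C"
        using CF C(1) by (auto simp: F_def ideal_set_def)
      show "x + y \<in> \<Union>C" if xy: "x \<in> \<Union>C" "y \<in> \<Union>C" for x y
      proof -
        from xy obtain J K where JK: "x \<in> J" "J \<in> C" "y \<in> K" "K \<in> C"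
          by blast
        have "\<exists>L\<in>C. x \<in> L \<and> y \<in> L"
          using ch[OF JK(2,4)] JK by (auto dest: subsetD)
        then obtain L where L: "L \<in> C" "x \<in> L" "y \<in> L"
          by blast
        then have "ideal_set A L"
          using CF by (auto simp: F_def)
        then show ?thesis
          using ideal_add L by blast
      qed
      show "a * x \<in> \<Union>C" if "a \<in> A" "x \<in> \<Union>C" for a x
        using that CF ideal_mult unfolding F_def by blast
    qed
    then show "\<Union>C \<in> F"
      using CF C(1) by (auto simp: F_def)
  qed
  then obtain N where N: "N \<in> F" and mx: "\<And>J. J \<in> F \<Longrightarrow> N \<subseteq> J \<Longrightarrow> J = N"
    by blast
  have idN: "ideal_set A N" and PN: "P \<subseteq> N" and fN: "\<And>k. f ^ k \<notin> N"
    using N by (auto simp: F_def)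
  have gold: "\<exists>y\<in>A. \<exists>k. f ^ k - x * y \<in> N" if x: "x \<in> A - N" for x
  proof -
    let ?J = "{t \<in> A. \<exists>y\<in>A. t - x * y \<in> N}"
    \<comment> \<open>\<open>?J\<close> is strictly larger than \<open>N\<close> because it contains
      \<open>x\<close>; being an ideal above \<open>P\<close>, it can fall outside \<open>F\<close>
      only by containing a power of \<open>f\<close>.\<close>
    have "?J \<notin> F"
      using mx[of ?J] subset_ideal_extend[OF idN, of x] mem_ideal_extend[OF idN, of x] x
      by blast
    then show ?thesis
      using ideal_extend[OF idN, of x] subset_ideal_extend[OF idN, of x] x PN
      unfolding F_def by blast
  qed
  have "x \<in> N \<or> y \<in> N" if xy: "x \<in> A" "y \<in> A" "x * y \<in> N" for x y
  proof (rule ccontr)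
    assume "\<not> (x \<in> N \<or> y \<in> N)"
    then obtain u k v l where u: "u \<in> A" "f ^ k - x * u \<in> N" and v: "v \<in> A" "f ^ l - y * v \<in> N"
      using gold xy by (metis DiffI)
    have fl: "f ^ l \<in> A" using f subring_power by blast
    \<comment> \<open>All mixed terms cancel and leave \<open>f ^ (l + k)\<close>.\<close>
    have "f ^ l * (f ^ k - x * u) + ((x * u) * (f ^ l - y * v) + (u * v) * (x * y)) \<in> N"
      by (intro ideal_add[OF idN] ideal_mult[OF idN] subring_mult xy u v fl)
    then have "f ^ (l + k) \<in> N"
      by (simp add: algebra_simps power_add)
    then show False using fN by blast
  qed
  then have "goldman_set A N f"
    using idN fN[of 0] fN[of 1] f gold by (auto simp: goldman_set_def prime_set_def)
  then show thesis using that PN by blast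
qed

text \<open>If a Goldman prime \<open>N\<close> is an intersection of maximal ideals, one of them
  omits \<open>f\<close>; it contains no power of \<open>f\<close>, so it cannot be strictly larger
  than \<open>N\<close>. Conversely, for each \<open>f\<close> outside \<open>P\<close> a Goldman
  prime above \<open>P\<close> omits \<open>f\<close>, and it is maximal by assumption, so the
  maximal ideals above \<open>P\<close> intersect in \<open>P\<close>.\<close>

lemma hilbert_ring_on: "hilbert_ring (ring_on A) \<longleftrightarrow> hilbert_set A"
proof
  assume H: "hilbert_ring (ring_on A)"
  show "hilbert_set A"
    unfolding hilbert_set_def
  proof (intro allI impI)
    fix N f assume G: "goldman_set A N f"
    then have "prime_set A N" by (simp add: goldman_set_def)
    then obtain \<M> where "\<And>M. M \<in> \<M> \<Longrightarrow> maximalideal M (ring_on A)" "N = \<Inter>\<M>"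
      using H primeideal_ring_on by (metis hilbert_ring_def)
    moreover have "f \<notin> N" using G by (simp add: goldman_set_def)
    ultimately obtain M where M: "maximalideal M (ring_on A)" "N \<subseteq> M" "f \<notin> M"
      by blast
    interpret cring "ring_on A" by (rule cring_ring_on)
    have Mp: "prime_set A M"
      using maximalideal_prime[OF M(1)] primeideal_ring_on by blast
    then have idM: "ideal_set A M" by (simp add: prime_set_def)
    have fA: "f \<in> A" using G by (simp add: goldman_set_def)
    have fM: "f ^ k \<notin> M" for k
      using Mp fA M(3) subring_power by (induction k) (auto simp: prime_set_def)
    have "x \<in> N" if x: "x \<in> M" for x
    proof (rule ccontr)
      assume "x \<notin> N"
      then have "x \<in> A - N"
        using x ideal_subset[OF idM] by blast
      then obtain y k where y: "y \<in> A" "f ^ k - x * y \<in> N"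
        using G unfolding goldman_set_def by blast
      have "(f ^ k - x * y) + y * x \<in> M"
        using y x M(2) ideal_add[OF idM] ideal_mult[OF idM] by blast
      then show False using fM by (simp add: mult.commute)
    qed
    then have "N = M" using M(2) by blast
    then show "maximal_set A N" using M maximalideal_ring_on by blast
  qed
next
  assume H: "hilbert_set A"
  show "hilbert_ring (ring_on A)"
    unfolding hilbert_ring_def
  proof (intro conjI allI impI cring_ring_on)
    fix P assume "primeideal P (ring_on A)"
    then have P: "prime_set A P" using primeideal_ring_on by blast
    let ?M = "{M. maximal_set A M \<and> P \<subseteq> M}"
    have ex: "\<exists>M\<in>?M. f \<notin> M" if "f \<in> A - P" for f
    proof -
      obtain N where "goldman_set A N f" "P \<subseteq> N"
        using goldman_set_exists[OF P \<open>f \<in> A - P\<close>] by blast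
      then show ?thesis
        using H by (auto simp: hilbert_set_def goldman_set_def)
    qed
    \<comment> \<open>Taking \<open>f = 1\<close> provides at least one maximal ideal above
      \<open>P\<close>; the intersection of an empty family would be the whole type.\<close>
    have ne: "?M \<noteq> {}"
      using ex[of 1] P subring_one by (auto simp: prime_set_def)
    moreover have "\<Inter>?M \<subseteq> A"
      using ne by (auto simp: maximal_set_def ideal_set_def)
    then have "P = \<Inter>?M"
      using ex by blast
    ultimately show "\<exists>\<M>. \<M> \<noteq> {} \<and> (\<forall>M\<in>\<M>. maximalideal M (ring_on A)) \<and> P = \<Inter>\<M>"
      using maximalideal_ring_on by (intro exI[of _ ?M]) simp
  qed
qed

end

lemma hilbert_domain_ring_on:
  fixes A :: "'r::idom set"
  assumes "subring_set A"
  shows "hilbert_domain (ring_on A) \<longleftrightarrow> hilbert_set A"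
proof -
  interpret cring "ring_on A" by (rule cring_ring_on[OF assms])
  have "domain (ring_on A)"
    by (rule domain.intro[OF is_cring]) (unfold_locales, auto)
  then show ?thesis
    using hilbert_ring_on[OF assms] by (simp add: hilbert_domain_def)
qed


section \<open>Transfer of the Hilbert property along homomorphisms and common ideals\<close>

definition hom_set :: "'r::comm_ring_1 set \<Rightarrow> ('r \<Rightarrow> 'q::comm_ring_1) \<Rightarrow> bool" where
  "hom_set A h \<longleftrightarrow> h 1 = 1 \<and> (\<forall>x\<in>A. \<forall>y\<in>A. h (x + y) = h x + h y \<and> h (x * y) = h x * h y)"

context
  fixes A :: "'r::comm_ring_1 set" and h :: "'r \<Rightarrow> 'q::comm_ring_1"
  assumes A: "subring_set A" and h: "hom_set A h"
begin

lemma hom_one: "h 1 = 1"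
  and hom_add: "x \<in> A \<Longrightarrow> y \<in> A \<Longrightarrow> h (x + y) = h x + h y"
  and hom_mult: "x \<in> A \<Longrightarrow> y \<in> A \<Longrightarrow> h (x * y) = h x * h y"
  using h by (auto simp: hom_set_def)

lemma hom_diff: "x \<in> A \<Longrightarrow> y \<in> A \<Longrightarrow> h (x - y) = h x - h y"
  using hom_add[of "x - y" y] subring_diff[OF A, of x y] by simp

lemma hom_zero: "h 0 = 0"
  using hom_add[of 0 0] subring_zero[OF A] by simp

lemma hom_power: "x \<in> A \<Longrightarrow> h (x ^ k) = h x ^ k"
  by (induction k) (simp_all add: hom_one hom_mult subring_power[OF A])

lemma subring_image: "subring_set (h ` A)"
  unfolding subring_set_def
proof (intro conjI ballI)
  show "1 \<in> h ` A"
    using hom_one subring_one[OF A] by (metis imageI)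
  fix u v assume "u \<in> h ` A" "v \<in> h ` A"
  then obtain x y where "x \<in> A" "y \<in> A" "u = h x" "v = h y" by blast
  then show "u - v \<in> h ` A" "u * v \<in> h ` A"
    by (auto simp: hom_diff[symmetric] hom_mult[symmetric] intro!: imageI subring_diff[OF A] subring_mult[OF A])
qed

text \<open>The preimage of a Goldman prime is Goldman, with any preimage of \<open>g\<close> as
  witness. It is therefore maximal, and inverses modulo it map to inverses modulo
  \<open>N\<close>.\<close>

lemma hilbert_set_image:
  assumes H: "hilbert_set A"
  shows "hilbert_set (h ` A)"
  unfolding hilbert_set_def
proof (intro allI impI)
  fix N g assume G: "goldman_set (h ` A) N g"
  then have prN: "prime_set (h ` A) N" by (simp add: goldman_set_def)
  then have idN: "ideal_set (h ` A) N" by (simp add: prime_set_def)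
  from G obtain f where f: "f \<in> A" "g = h f" by (auto simp: goldman_set_def)
  let ?N = "{x \<in> A. h x \<in> N}"
  have id: "ideal_set A ?N"
    using idN by (auto simp: ideal_set_def hom_add hom_mult hom_zero subring_zero[OF A]
      subring_add[OF A] subring_mult[OF A])
  have pr: "prime_set A ?N"
    using prN id by (auto simp: prime_set_def hom_one hom_mult)
  have "\<exists>y\<in>A. \<exists>k. f ^ k - x * y \<in> ?N" if x: "x \<in> A - ?N" for x
  proof -
    have "h x \<in> h ` A - N" using x by blast
    then obtain y k where y: "y \<in> A" "g ^ k - h x * h y \<in> N"
      using G unfolding goldman_set_def by blast
    have "h (f ^ k - x * y) = g ^ k - h x * h y"
      using x y f by (simp add: hom_diff hom_mult hom_power subring_power[OF A] subring_mult[OF A])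
    then have "f ^ k - x * y \<in> ?N"
      using x y f by (simp add: subring_diff[OF A] subring_power[OF A] subring_mult[OF A])
    then show ?thesis using y by blast
  qed
  then have "goldman_set A ?N f"
    using pr f G by (simp add: goldman_set_def)
  then have mx: "maximal_set A ?N"
    using hilbert_setD[OF H] by blast
  have "\<exists>y\<in>h ` A. 1 - x * y \<in> N" if x: "x \<in> h ` A - N" for x
  proof -
    obtain a where a: "a \<in> A - ?N" "x = h a" using x by blast
    then obtain y where y: "y \<in> A" "1 - a * y \<in> ?N"
      using mx unfolding maximal_set_def by blast
    then have "h (1 - a * y) \<in> N" by simp
    then have "1 - x * h y \<in> N"
      using a y by (simp add: hom_diff hom_mult hom_one subring_one[OF A] subring_mult[OF A])
    then show ?thesis using y by blast
  qed
  then show "maximal_set (h ` A) N"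
    using prN by (simp add: prime_set_def maximal_set_def)
qed

lemma maximal_set_of_image:
  assumes H: "hilbert_set (h ` A)" and G: "goldman_set A N f"
    and ker: "\<And>x. x \<in> A \<Longrightarrow> h x = 0 \<Longrightarrow> x \<in> N"
  shows "maximal_set A N"
proof -
  have prN: "prime_set A N" using G by (simp add: goldman_set_def)
  then have idN: "ideal_set A N" by (simp add: prime_set_def)
  have mem: "h x \<in> h ` N \<longleftrightarrow> x \<in> N" if x: "x \<in> A" for x
  proof
    assume "h x \<in> h ` N"
    then obtain n where n: "n \<in> N" "h x = h n" by blast
    have nA: "n \<in> A" using ideal_subset[OF A idN] n by blast
    have "x - n \<in> N"
      by (rule ker) (use n x nA in \<open>auto simp: hom_diff subring_diff[OF A]\<close>)
    then show "x \<in> N"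
      using ideal_add[OF A idN, of "x - n" n] n by simp
  qed simp
  note sub = ideal_subset[OF A idN]
  have id: "ideal_set (h ` A) (h ` N)"
    unfolding ideal_set_def
  proof (intro conjI ballI)
    show "h ` N \<subseteq> h ` A" using sub by blast
    show "0 \<in> h ` N" using hom_zero ideal_zero[OF A idN] by (metis imageI)
    show "u + v \<in> h ` N" if "u \<in> h ` N" "v \<in> h ` N" for u v
      using that ideal_add[OF A idN] sub by (auto simp: hom_add[symmetric])
    show "u * v \<in> h ` N" if "u \<in> h ` A" "v \<in> h ` N" for u v
      using that ideal_mult[OF A idN] sub by (auto simp: hom_mult[symmetric])
  qed
  have "1 \<notin> h ` N"
    using mem[of 1] prN hom_one subring_one[OF A] by (auto simp: prime_set_def)
  moreover have "u \<in> h ` N \<or> v \<in> h ` N" if uv: "u \<in> h ` A" "v \<in> h ` A" "u * v \<in> h ` N" for u v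
  proof -
    obtain x y where xy: "x \<in> A" "y \<in> A" "u = h x" "v = h y" using uv by blast
    then have "x * y \<in> N"
      using uv mem[of "x * y"] by (simp add: hom_mult subring_mult[OF A])
    then show ?thesis using prN xy by (auto simp: prime_set_def)
  qed
  ultimately have pr: "prime_set (h ` A) (h ` N)"
    using id by (simp add: prime_set_def)
  have f: "f \<in> A" "f \<notin> N" using G by (auto simp: goldman_set_def)
  have "\<exists>v\<in>h ` A. \<exists>k. h f ^ k - u * v \<in> h ` N" if u: "u \<in> h ` A - h ` N" for u
  proof -
    obtain x where x: "x \<in> A - N" "u = h x" using u by blast
    then obtain y k where y: "y \<in> A" "f ^ k - x * y \<in> N"
      using G unfolding goldman_set_def by blast
    have "h (f ^ k - x * y) = h f ^ k - u * h y"
      using x y f by (simp add: hom_diff hom_mult hom_power subring_power[OF A] subring_mult[OF A])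
    then have "h f ^ k - u * h y \<in> h ` N" using y by (metis imageI)
    then show ?thesis using y by blast
  qed
  then have "goldman_set (h ` A) (h ` N) (h f)"
    using pr f mem by (simp add: goldman_set_def)
  then have mx: "maximal_set (h ` A) (h ` N)"
    using hilbert_setD[OF H] by blast
  have "\<exists>y\<in>A. 1 - x * y \<in> N" if x: "x \<in> A - N" for x
  proof -
    have "h x \<in> h ` A - h ` N" using x mem by blast
    then obtain y where y: "y \<in> A" "1 - h x * h y \<in> h ` N"
      using mx unfolding maximal_set_def by blast
    have "h (1 - x * y) = 1 - h x * h y"
      using x y by (simp add: hom_diff hom_mult hom_one subring_one[OF A] subring_mult[OF A])
    then have "1 - x * y \<in> N"
      using x y mem[of "1 - x * y"] by (simp add: subring_diff[OF A] subring_one[OF A] subring_mult[OF A])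
    then show ?thesis using y by blast
  qed
  then show ?thesis
    using prN by (simp add: prime_set_def maximal_set_def)
qed

end

text \<open>A prime \<open>N\<close> of \<open>A\<close> not containing the common ideal \<open>I\<close> of \<open>A\<close> and \<open>B\<close> is the
  contraction of the prime \<open>{b. I b \<subseteq> N}\<close> of \<open>B\<close>.\<close>

lemma hilbert_set_common_ideal:
  fixes A B I :: "'r::comm_ring_1 set" and h :: "'r \<Rightarrow> 'q::comm_ring_1"
  assumes A: "subring_set A" and B: "subring_set B" and AB: "A \<subseteq> B"
    and I: "ideal_set B I" and IA: "I \<subseteq> A"
    and HB: "hilbert_set B"
    and h: "hom_set A h" and ker: "\<And>x. x \<in> A \<Longrightarrow> h x = 0 \<Longrightarrow> x \<in> I"
    and Hh: "hilbert_set (h ` A)"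
  shows "hilbert_set A"
  unfolding hilbert_set_def
proof (intro allI impI)
  fix N f assume G: "goldman_set A N f"
  then have prN: "prime_set A N" by (simp add: goldman_set_def)
  then have idN: "ideal_set A N" by (simp add: prime_set_def)
  have f: "f \<in> A" "f \<notin> N" using G by (auto simp: goldman_set_def)
  show "maximal_set A N"
  proof (cases "I \<subseteq> N")
    case True
    then show ?thesis
      using maximal_set_of_image[OF A h Hh G] ker by blast
  next
    case False
    then obtain c where c: "c \<in> I" "c \<notin> N" by blast
    let ?N = "{b \<in> B. \<forall>i\<in>I. i * b \<in> N}"
    have iB: "i * b \<in> I" if "i \<in> I" "b \<in> B" for i b
      using ideal_mult_right[OF B I] that by blast
    have prime: "x \<in> N \<or> y \<in> N" if "x \<in> A" "y \<in> A" "x * y \<in> N" for x y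
      using prN that by (auto simp: prime_set_def)
    \<comment> \<open>Here \<open>c * x\<close> lies in \<open>N\<close> and \<open>c\<close> does
      not.\<close>
    have contr: "x \<in> N" if "x \<in> ?N" "x \<in> A" for x
      using prime[of c x] that c IA by blast
    have ext: "x \<in> ?N" if x: "x \<in> N" for x
      using ideal_mult[OF A idN] ideal_subset[OF A idN] x IA AB by blast
    have id: "ideal_set B ?N"
      unfolding ideal_set_def
    proof (intro conjI ballI)
      show "0 \<in> ?N"
        using subring_zero[OF B] ideal_zero[OF A idN] by simp
      show "x + y \<in> ?N" if "x \<in> ?N" "y \<in> ?N" for x y
        using that subring_add[OF B] ideal_add[OF A idN] by (simp add: distrib_left)
      show "b * x \<in> ?N" if "b \<in> B" "x \<in> ?N" for b x
        using that subring_mult[OF B] iB by (simp add: mult.assoc[symmetric])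
    qed blast
    have "1 \<notin> ?N"
      using c by auto
    moreover have "x \<in> ?N \<or> y \<in> ?N" if xy: "x \<in> B" "y \<in> B" "x * y \<in> ?N" for x y
    proof (rule ccontr)
      assume "\<not> ?thesis"
      then obtain i j where ij: "i \<in> I" "j \<in> I" "i * x \<notin> N" "j * y \<notin> N"
        using xy by blast
      have "i * (x * y) \<in> N"
        using ij xy by blast
      then have "j * (i * (x * y)) \<in> N"
        using ideal_mult[OF A idN] ij IA by blast
      then have "(i * x) * (j * y) \<in> N"
        by (simp add: mult_ac)
      then show False
        using prime ij iB xy IA by blast
    qed
    ultimately have pr: "prime_set B ?N"
      using id by (simp add: prime_set_def)
    have "\<exists>y\<in>B. \<exists>k. f ^ k - x * y \<in> ?N" if x: "x \<in> B - ?N" for x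
    proof -
      \<comment> \<open>Multiplying by \<open>i\<close> brings \<open>x\<close> into
        \<open>A\<close> without entering \<open>N\<close>, so the Goldman property applies to
        \<open>i * x\<close>; the factor \<open>i\<close> is then absorbed into the
        cofactor.\<close>
      obtain i where i: "i \<in> I" "i * x \<notin> N" using x by blast
      have "i * x \<in> A" using i x iB IA by blast
      then obtain y k where y: "y \<in> A" "f ^ k - (i * x) * y \<in> N"
        using G i unfolding goldman_set_def by blast
      have eq: "f ^ k - (i * x) * y = f ^ k - x * (i * y)"
        by (simp add: mult_ac)
      have "f ^ k - x * (i * y) \<in> ?N"
        using ext[OF y(2)] unfolding eq .
      moreover have "i * y \<in> B"
        using subring_mult[OF B] i y IA AB by blast
      ultimately show ?thesis by blast
    qed
    moreover have "f \<in> B - ?N"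
      using contr f AB by blast
    ultimately have "goldman_set B ?N f"
      using pr unfolding goldman_set_def by blast
    then have mx: "maximal_set B ?N"
      using hilbert_setD[OF HB] by blast
    \<comment> \<open>An inverse \<open>d\<close> of \<open>c\<close> modulo \<open>?N\<close> makes
      \<open>c * d\<close> an element of \<open>I\<close> congruent to 1 modulo \<open>N\<close>,
      which is the comaximality needed to descend.\<close>
    have cB: "c \<in> B - ?N" using contr c IA AB by blast
    obtain d where d: "d \<in> B" "1 - c * d \<in> ?N"
      using mx cB unfolding maximal_set_def by blast
    have cdI: "c * d \<in> I" using iB c d by blast
    have cd: "1 - c * d \<in> N"
      using contr d subring_diff[OF A subring_one[OF A]] cdI IA by blast
    have "\<exists>y\<in>A. 1 - x * y \<in> N" if x: "x \<in> A - N" for x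
    proof -
      have "x \<in> B - ?N" using x contr AB by blast
      then obtain y where y: "y \<in> B" "1 - x * y \<in> ?N"
        using mx unfolding maximal_set_def by blast
      \<comment> \<open>The inverse \<open>y\<close> of \<open>x\<close> lies only in
        \<open>B\<close>; multiplying it by \<open>c * d\<close> moves it into \<open>A\<close> and
        preserves the congruence, since \<open>c * d\<close> carries \<open>?N\<close> into
        \<open>N\<close>.\<close>
      have "(1 - c * d) + (c * d) * (1 - x * y) \<in> N"
        using ideal_add[OF A idN cd] y cdI by blast
      then have "1 - x * (c * d * y) \<in> N"
        by (simp add: algebra_simps)
      moreover have "c * d * y \<in> A" using cdI iB y IA by blast
      ultimately show ?thesis by blast
    qed
    then show ?thesis
      using idN prN by (simp add: maximal_set_def prime_set_def)
  qed
qed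


section \<open>Polynomials over a subring and their degree modulo an ideal\<close>

definition poly_set :: "'r::comm_ring_1 set \<Rightarrow> 'r poly set" where
  "poly_set A = {f. \<forall>i. poly.coeff f i \<in> A}"

text \<open>\<open>lead_mod P f n\<close> says that \<open>f\<close> has degree \<open>n\<close> modulo \<open>P\<close>.\<close>

definition lead_mod :: "'r::comm_ring_1 set \<Rightarrow> 'r poly \<Rightarrow> nat \<Rightarrow> bool" where
  "lead_mod P f n \<longleftrightarrow> poly.coeff f n \<notin> P \<and> (\<forall>i>n. poly.coeff f i \<in> P)"

lemma lead_mod_unique: "lead_mod P f m \<Longrightarrow> lead_mod P f n \<Longrightarrow> m = n"
  unfolding lead_mod_def by (meson linorder_neqE_nat)

lemma lead_mod_exists:
  assumes "0 \<in> P" "poly.coeff f i \<notin> P"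
  obtains n where "lead_mod P f n" "i \<le> n"
proof -
  let ?S = "{i. poly.coeff f i \<notin> P}"
  have "?S \<subseteq> {.. Polynomial.degree f}"
    using assms(1) by (auto intro: le_degree)
  then have fin: "finite ?S"
    using finite_subset by blast
  have "Max ?S \<in> ?S"
    using Max_in[OF fin] assms(2) by blast
  moreover have "\<forall>j > Max ?S. poly.coeff f j \<in> P"
    using Max_ge[OF fin] by (meson leD mem_Collect_eq)
  ultimately have "lead_mod P f (Max ?S)"
    unfolding lead_mod_def by blast
  moreover have "i \<le> Max ?S"
    by (rule Max_ge[OF fin]) (use assms(2) in simp)
  ultimately show thesis by (rule that)
qed

lemma subring_poly_set:
  assumes A: "subring_set A"
  shows "subring_set (poly_set A)"
  unfolding subring_set_def poly_set_def
  by (intro conjI ballI)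
     (simp_all add: subring_one[OF A] subring_zero[OF A] subring_diff[OF A] coeff_mult
        subring_sum[OF A] subring_mult[OF A])

lemma const_poly_set: "0 \<in> A \<Longrightarrow> a \<in> A \<Longrightarrow> [:a:] \<in> poly_set A"
  by (auto simp: poly_set_def coeff_pCons split: nat.split)

lemma monom_poly_set: "0 \<in> A \<Longrightarrow> a \<in> A \<Longrightarrow> monom a n \<in> poly_set A"
  by (auto simp: poly_set_def)

text \<open>Induction on a bound for the degree of \<open>h\<close> modulo \<open>P\<close>:
  multiplying by the coefficient \<open>a\<close> and subtracting a monomial multiple of
  \<open>g\<close> cancels the top coefficient. The final equation is exact; only the degree of the
  remainder is measured modulo \<open>P\<close>.\<close>

lemma pseudo_division_mod:
  assumes A: "subring_set A" and P: "ideal_set A P"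
    and g: "g \<in> poly_set A" "\<And>i. i > n \<Longrightarrow> poly.coeff g i \<in> P"
    and h: "h \<in> poly_set A"
  obtains k q r where "q \<in> poly_set A" "r \<in> poly_set A" "\<And>i. i \<ge> n \<Longrightarrow> poly.coeff r i \<in> P"
    "[:poly.coeff g n ^ k:] * h = q * g + r"
proof -
  define a where "a = poly.coeff g n"
  have aA: "a \<in> A" using g by (simp add: a_def poly_set_def)
  note B = subring_poly_set[OF A]
  have "\<exists>k q r. q \<in> poly_set A \<and> r \<in> poly_set A \<and> (\<forall>i\<ge>n. poly.coeff r i \<in> P) \<and> [:a ^ k:] * h = q * g + r"
    if "\<forall>i\<ge>m. poly.coeff h i \<in> P" "h \<in> poly_set A" for m h
    using that
  proof (induction m arbitrary: h)
    case 0
    then show ?case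
      using subring_zero[OF B] by (intro exI[of _ 0] exI[of _ h]) auto
  next
    case (Suc m)
    show ?case
    proof (cases "m < n")
      case True
      then show ?thesis
        using Suc.prems subring_zero[OF B] by (intro exI[of _ 0] exI[of _ h]) auto
    next
      case False
      define c where "c = poly.coeff h m"
      define h' where "h' = [:a:] * h - monom c (m - n) * g"
      have cA: "c \<in> A" using Suc.prems by (simp add: c_def poly_set_def)
      have mon: "monom c (m - n) \<in> poly_set A"
        using monom_poly_set[OF subring_zero[OF A] cA] .
      have "h' \<in> poly_set A"
        unfolding h'_def
        by (intro subring_diff[OF B] subring_mult[OF B] mon Suc.prems g const_poly_set[OF subring_zero[OF A]] aA)
      moreover have "poly.coeff h' i \<in> P" if i: "i \<ge> m" for i
      proof -
        have co: "poly.coeff h' i = a * poly.coeff h i - c * poly.coeff g (i - (m - n))"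
          using i False by (simp add: h'_def coeff_monom_mult)
        show ?thesis
        proof (cases "i = m")
          case True
          then show ?thesis
            using co False ideal_zero[OF A P] by (simp add: c_def a_def)
        next
          case ne: False
          have "poly.coeff h i \<in> P" "poly.coeff g (i - (m - n)) \<in> P"
            using Suc.prems(1) i ne False by (auto intro!: g(2))
          then show ?thesis
            unfolding co by (intro ideal_diff[OF A P] ideal_mult[OF A P] aA cA)
        qed
      qed
      ultimately obtain k q r where IH: "q \<in> poly_set A" "r \<in> poly_set A"
        "\<forall>i\<ge>n. poly.coeff r i \<in> P" "[:a ^ k:] * h' = q * g + r"
        using Suc.IH[of h'] by blast
      have "[:a ^ Suc k:] * h = [:a ^ k:] * h' + [:a ^ k:] * (monom c (m - n) * g)"
        by (simp add: h'_def algebra_simps smult_diff_right)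
      also have "\<dots> = (q + [:a ^ k:] * monom c (m - n)) * g + r"
        unfolding IH(4) by (simp only: algebra_simps)
      finally show ?thesis
        by (intro exI[of _ "Suc k"] exI[of _ "q + [:a ^ k:] * monom c (m - n)"] exI[of _ r] conjI
            subring_add[OF B] subring_mult[OF B] IH mon
            const_poly_set[OF subring_zero[OF A] subring_power[OF A aA]])
    qed
  qed
  moreover have "\<forall>i\<ge>Suc (Polynomial.degree h). poly.coeff h i \<in> P"
    using ideal_zero[OF A P] by (simp add: coeff_eq_0 Suc_le_eq)
  ultimately show thesis
    using that h unfolding a_def by blast
qed

text \<open>Degrees add because \<open>A / P\<close> is a domain: in degree \<open>m + n\<close>
  every summand except the product of the two leading coefficients lies in \<open>P\<close>.\<close>

lemma lead_mod_mult:
  assumes A: "subring_set A" and P: "prime_set A P"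
    and f: "f \<in> poly_set A" "lead_mod P f m" and g: "g \<in> poly_set A" "lead_mod P g n"
  shows "lead_mod P (f * g) (m + n)"
proof -
  have idP: "ideal_set A P" using P by (simp add: prime_set_def)
  have fA: "\<And>i. poly.coeff f i \<in> A" and gA: "\<And>i. poly.coeff g i \<in> A"
    using f g by (auto simp: poly_set_def)
  have prod_in: "poly.coeff f j * poly.coeff g (i - j) \<in> P" if "i \<ge> m + n" "j \<noteq> m \<or> i > m + n" for i j
  proof (cases "j > m")
    case True
    then show ?thesis
      using f gA by (intro ideal_mult_right[OF A idP]) (auto simp: lead_mod_def)
  next
    case False
    then have "i - j > n" using that by auto
    then show ?thesis
      using g fA by (intro ideal_mult[OF A idP]) (auto simp: lead_mod_def)
  qed
  have "poly.coeff (f * g) i \<in> P" if "i > m + n" for i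
    unfolding coeff_mult by (rule ideal_sum[OF A idP], rule prod_in) (use that in auto)
  moreover have "poly.coeff (f * g) (m + n) \<notin> P"
  proof
    assume "poly.coeff (f * g) (m + n) \<in> P"
    moreover have "poly.coeff (f * g) (m + n) = poly.coeff f m * poly.coeff g n
        + (\<Sum>j\<in>{..m + n} - {m}. poly.coeff f j * poly.coeff g (m + n - j))"
      unfolding coeff_mult by (subst sum.remove[of _ m]) auto
    moreover have "(\<Sum>j\<in>{..m + n} - {m}. poly.coeff f j * poly.coeff g (m + n - j)) \<in> P"
      by (rule ideal_sum[OF A idP], rule prod_in) auto
    ultimately have "poly.coeff f m * poly.coeff g n \<in> P"
      using ideal_diff[OF A idP] by (metis add_diff_cancel_right')
    then show False
      using P fA[of m] gA[of n] f(2) g(2) unfolding prime_set_def lead_mod_def by blast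
  qed
  ultimately show ?thesis by (simp add: lead_mod_def)
qed

section \<open>The general Nullstellensatz: a prime of \<open>A[X]\<close> and its contraction to
  \<open>A\<close>\<close>

context
  fixes A :: "'r::comm_ring_1 set" and N :: "'r poly set" and P :: "'r set"
  assumes A: "subring_set A" and N: "prime_set (poly_set A) N"
    and P_def: "P = {a \<in> A. [:a:] \<in> N}"
begin

lemmas subring_polys = subring_poly_set[OF A]

lemma ideal_N: "ideal_set (poly_set A) N"
  using N by (simp add: prime_set_def)

lemma prime_N: "x \<in> poly_set A \<Longrightarrow> y \<in> poly_set A \<Longrightarrow> x * y \<in> N \<Longrightarrow> x \<in> N \<or> y \<in> N"
  using N by (simp add: prime_set_def)

lemma const_in_polys: "a \<in> A \<Longrightarrow> [:a:] \<in> poly_set A"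
  by (rule const_poly_set[OF subring_zero[OF A]])

lemma prime_contraction: "prime_set A P"
proof -
  have mult: "[:a * b:] = [:a:] * [:b:]" and add: "[:a + b:] = [:a:] + [:b:]" for a b :: 'r
    by simp_all
  have "ideal_set A P"
    unfolding ideal_set_def
  proof (intro conjI ballI)
    show "0 \<in> P"
      using ideal_zero[OF subring_polys ideal_N] subring_zero[OF A] by (simp add: P_def)
    show "a + b \<in> P" if "a \<in> P" "b \<in> P" for a b
      using that ideal_add[OF subring_polys ideal_N] subring_add[OF A] unfolding P_def add mem_Collect_eq by blast
    show "a * b \<in> P" if "a \<in> A" "b \<in> P" for a b
      using that ideal_mult[OF subring_polys ideal_N const_in_polys] subring_mult[OF A] unfolding P_def mult mem_Collect_eq by blast
  qed (simp add: P_def)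
  moreover have "1 \<notin> P"
    using N by (simp add: P_def prime_set_def one_pCons)
  moreover have "a \<in> P \<or> b \<in> P" if "a \<in> A" "b \<in> A" "a * b \<in> P" for a b
    using that prime_N[OF const_in_polys const_in_polys, of a b] unfolding P_def mult mem_Collect_eq by blast
  ultimately show ?thesis by (simp add: prime_set_def)
qed

lemma ideal_contraction: "ideal_set A P"
  using prime_contraction by (simp add: prime_set_def)

text \<open>The extension of \<open>P\<close> to \<open>A[X]\<close> lies in \<open>N\<close>, by
  splitting off the constant term. Hence congruences modulo \<open>P\<close>, coefficient by
  coefficient, are congruences modulo \<open>N\<close>.\<close>

lemma coeffs_in_contraction: "(\<And>i. poly.coeff f i \<in> P) \<Longrightarrow> f \<in> N"
proof (induction f)
  case 0
  then show ?case by (simp add: ideal_zero[OF subring_polys ideal_N])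
next
  case (pCons a f)
  have "[:a:] \<in> N" using pCons.prems[of 0] by (simp add: P_def)
  moreover have "f \<in> N" using pCons.IH pCons.prems[of "Suc _"] by simp
  moreover have "monom 1 1 \<in> poly_set A"
    by (rule monom_poly_set[OF subring_zero[OF A] subring_one[OF A]])
  ultimately have "[:a:] + monom 1 1 * f \<in> N"
    by (intro ideal_add[OF subring_polys ideal_N] ideal_mult[OF subring_polys ideal_N])
  then show ?case by (simp add: monom_altdef)
qed

lemma lead_mod_not_in:
  assumes "f \<notin> N"
  obtains n where "lead_mod P f n"
  using assms coeffs_in_contraction lead_mod_exists[OF ideal_zero[OF A ideal_contraction]] by metis

text \<open>If all coefficients of all elements of \<open>N\<close> were in \<open>P\<close>, then \<open>g = 1 + X f\<close> would divide a power
  of \<open>f\<close> modulo \<open>P\<close>; being coprime to \<open>f\<close>, it would be a unit of positive degree modulo \<open>P\<close>.\<close>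

lemma goldman_contains_nonzero_mod:
  assumes G: "goldman_set (poly_set A) N f"
  obtains g n where "g \<in> N" "lead_mod P g n"
proof (rule ccontr)
  assume "\<not> thesis"
  with that have no: "\<And>g n. g \<in> N \<Longrightarrow> \<not> lead_mod P g n" by blast
  have fB: "f \<in> poly_set A" and fN: "f \<notin> N" using G by (auto simp: goldman_set_def)
  obtain m where m: "lead_mod P f m" using lead_mod_not_in[OF fN] .
  let ?X = "monom 1 1 :: 'r poly"
  have XB: "?X \<in> poly_set A"
    by (rule monom_poly_set[OF subring_zero[OF A] subring_one[OF A]])
  define g where "g = 1 + ?X * f"
  have gB: "g \<in> poly_set A"
    unfolding g_def by (intro subring_add[OF subring_polys] subring_one[OF subring_polys] subring_mult[OF subring_polys] XB fB)
  have co: "poly.coeff g (Suc i) = poly.coeff f i" for i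
    by (simp add: g_def coeff_monom_mult)
  have g_lead: "lead_mod P g (Suc m)"
    unfolding lead_mod_def
  proof (intro conjI allI impI)
    show "poly.coeff g (Suc m) \<notin> P" using m by (simp add: co lead_mod_def)
    fix i assume "Suc m < i"
    then obtain j where "i = Suc j" "m < j" by (cases i) auto
    then show "poly.coeff g i \<in> P" using m by (simp add: co lead_mod_def)
  qed
  have "g \<in> poly_set A - N" using no g_lead gB by blast
  then obtain y k where y: "y \<in> poly_set A" "f ^ k - g * y \<in> N"
    using G unfolding goldman_set_def by blast
  \<comment> \<open>By the choice of \<open>g\<close>, the product \<open>X f\<close> is congruent
    to -1 modulo \<open>g\<close>, so its powers are signs modulo \<open>g\<close>.\<close>
  have ex: "\<exists>z\<in>poly_set A. (?X * f) ^ j = (- 1) ^ j + g * z" for j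
  proof (induction j)
    case 0
    show ?case using subring_zero[OF subring_polys] by (intro bexI[of _ 0]) auto
  next
    case (Suc j)
    then obtain z where z: "z \<in> poly_set A" "(?X * f) ^ j = (- 1) ^ j + g * z" by blast
    have "(?X * f) ^ Suc j = (g - 1) * ((- 1) ^ j + g * z)"
      using z by (simp add: g_def)
    also have "\<dots> = (- 1) ^ Suc j + g * ((- 1) ^ j + (g - 1) * z)"
      by (simp add: algebra_simps)
    finally show ?case
      using z gB subring_power[OF subring_polys subring_uminus[OF subring_polys subring_one[OF subring_polys]]]
      by (intro bexI[of _ "(- 1) ^ j + (g - 1) * z"] subring_add[OF subring_polys] subring_mult[OF subring_polys]
          subring_diff[OF subring_polys] subring_one[OF subring_polys])
  qed
  obtain z where z: "z \<in> poly_set A" "(?X * f) ^ k = (- 1) ^ k + g * z" using ex by blast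
  \<comment> \<open>This is the inverse of \<open>g\<close> modulo \<open>N\<close>, found by
    multiplying the congruence of \<open>f ^ k\<close> and \<open>g * y\<close> by
    \<open>(- 1) ^ k * X ^ k\<close> and replacing \<open>(X f) ^ k\<close>.\<close>
  define w where "w = (- 1) ^ k * (?X ^ k * y - z)"
  have wB: "w \<in> poly_set A"
    unfolding w_def
    by (intro subring_mult[OF subring_polys] subring_power[OF subring_polys] subring_diff[OF subring_polys] subring_uminus[OF subring_polys] subring_one[OF subring_polys] XB y z)
  have "(- 1) ^ k * ?X ^ k * (f ^ k - g * y) \<in> N"
    by (intro ideal_mult[OF subring_polys ideal_N] y subring_mult[OF subring_polys] subring_power[OF subring_polys] subring_uminus[OF subring_polys] subring_one[OF subring_polys] XB)
  also have "(- 1) ^ k * ?X ^ k * (f ^ k - g * y) = (- 1) ^ k * (?X * f) ^ k - (- 1) ^ k * ?X ^ k * g * y"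
    by (simp add: algebra_simps power_mult_distrib)
  also have "\<dots> = (- 1) ^ k * (- 1) ^ k - g * w"
    unfolding z w_def by (simp add: algebra_simps)
  also have "(- 1) ^ k * (- 1) ^ k = (1 :: 'r poly)"
    by (simp add: power_mult_distrib[symmetric])
  finally have one: "1 - g * w \<in> N" .
  have "w \<notin> N"
  proof
    assume "w \<in> N"
    then have "(1 - g * w) + g * w \<in> N"
      using ideal_add[OF subring_polys ideal_N one ideal_mult[OF subring_polys ideal_N gB]] by blast
    then show False using N by (simp add: prime_set_def)
  qed
  then obtain j where "lead_mod P w j" using lead_mod_not_in by blast
  \<comment> \<open>The degree is positive, so subtracting from 1 cannot cancel the leading
    coefficient; \<open>1 - g * w\<close> is then an element of \<open>N\<close> with a coefficient
    outside \<open>P\<close>.\<close>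
  then have "lead_mod P (g * w) (Suc m + j)"
    using lead_mod_mult[OF A prime_contraction gB g_lead wB] by blast
  then have "poly.coeff (1 - g * w) (Suc m + j) \<notin> P"
    using ideal_uminus[OF A ideal_contraction, of "poly.coeff (1 - g * w) (Suc m + j)"] by (auto simp: lead_mod_def)
  then show False
    using one no lead_mod_exists[OF ideal_zero[OF A ideal_contraction]] by metis
qed

text \<open>An element \<open>r\<close> of least degree modulo \<open>P\<close> in \<open>N + h A[X]\<close> pseudo-divides \<open>g\<close>, with a quotient
  in \<open>N\<close>. Minimality of the degree of \<open>g\<close> forces \<open>r\<close> to be constant modulo \<open>P\<close>.\<close>

lemma divides_const_mod:
  assumes g: "g \<in> N" "lead_mod P g n"
    and min: "\<And>g' n'. g' \<in> N \<Longrightarrow> lead_mod P g' n' \<Longrightarrow> n \<le> n'"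
    and h: "h \<in> poly_set A - N"
  obtains e b where "e \<in> poly_set A" "b \<in> A - P" "[:b:] - h * e \<in> N"
proof -
  let ?J = "{t \<in> poly_set A. \<exists>e\<in>poly_set A. t - h * e \<in> N}"
  have hB: "h \<in> poly_set A" and hN: "h \<notin> N" using h by auto
  have idJ: "ideal_set (poly_set A) ?J" by (rule ideal_extend[OF subring_polys ideal_N hB])
  have NJ: "N \<subseteq> ?J" by (rule subset_ideal_extend[OF subring_polys ideal_N])
  have hJ: "h \<in> ?J" by (rule mem_ideal_extend[OF subring_polys ideal_N hB])
  obtain m0 where m0: "lead_mod P h m0" using lead_mod_not_in[OF hN] .
  define m where "m = (LEAST m. \<exists>r\<in>?J. lead_mod P r m)"
  have "\<exists>r\<in>?J. lead_mod P r m"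
    unfolding m_def by (rule LeastI[of _ m0]) (use hJ m0 in blast)
  then obtain r where rJ: "r \<in> ?J" and r: "lead_mod P r m" by blast
  have rB: "r \<in> poly_set A" using rJ by simp
  \<comment> \<open>By minimality of \<open>m\<close>, a remainder in \<open>?J\<close> of degree
    below \<open>m\<close> vanishes modulo \<open>P\<close>.\<close>
  have low: "poly.coeff t j \<in> P" if t: "t \<in> ?J" "\<And>i. i \<ge> m \<Longrightarrow> poly.coeff t i \<in> P" for t j
  proof (rule ccontr)
    assume "poly.coeff t j \<notin> P"
    then obtain i where i: "lead_mod P t i" using lead_mod_exists[OF ideal_zero[OF A ideal_contraction]] by blast
    then have "m \<le> i" unfolding m_def using t(1) by (intro Least_le) blast
    then show False using t(2) i by (simp add: lead_mod_def)
  qed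
  define c where "c = poly.coeff r m"
  have cA: "c \<in> A" using rB by (simp add: c_def poly_set_def)
  have cP: "c ^ k \<notin> P" for k
    using prime_contraction r cA subring_power[OF A cA]
    by (induction k) (auto simp: c_def lead_mod_def prime_set_def)
  have div: "\<exists>k q t. q \<in> poly_set A \<and> (\<forall>i. poly.coeff t i \<in> P) \<and> [:c ^ k:] * u = q * r + t" if u: "u \<in> ?J" for u
  proof -
    have uB: "u \<in> poly_set A" using u by simp
    obtain k q t where q: "q \<in> poly_set A" "t \<in> poly_set A" "\<And>i. i \<ge> m \<Longrightarrow> poly.coeff t i \<in> P"
      "[:c ^ k:] * u = q * r + t"
      using pseudo_division_mod[OF A ideal_contraction rB, of m u] r uB unfolding c_def lead_mod_def by metis
    have "[:c ^ k:] * u - q * r \<in> ?J"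
      by (intro ideal_diff[OF subring_polys idJ] ideal_mult[OF subring_polys idJ] u rJ q const_in_polys subring_power[OF A cA])
    then have "t \<in> ?J" using q(4) by simp
    then have "\<forall>i. poly.coeff t i \<in> P" using low q(3) by blast
    then show ?thesis using q by blast
  qed
  \<comment> \<open>Otherwise dividing \<open>h\<close> by \<open>r\<close> would put
    \<open>c ^ k\<close> times \<open>h\<close> into the prime \<open>N\<close>, although neither
    factor lies there.\<close>
  have rN: "r \<notin> N"
  proof
    assume "r \<in> N"
    obtain k q t where q: "q \<in> poly_set A" "\<forall>i. poly.coeff t i \<in> P" "[:c ^ k:] * h = q * r + t"
      using div[OF hJ] by blast
    have "[:c ^ k:] * h \<in> N"
      unfolding q(3) using q(2)
      by (intro ideal_add[OF subring_polys ideal_N] ideal_mult[OF subring_polys ideal_N] q(1) \<open>r \<in> N\<close> coeffs_in_contraction) blast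
    then have "[:c ^ k:] \<in> N"
      using prime_N[OF const_in_polys[OF subring_power[OF A cA]] hB] hN by blast
    then show False using cP subring_power[OF A cA] by (simp add: P_def)
  qed
  obtain k q t where q: "q \<in> poly_set A" and t: "\<And>i. poly.coeff t i \<in> P"
    and eq: "[:c ^ k:] * g = q * r + t"
    using div[of g] NJ g(1) by blast
  have tN: "t \<in> N" using coeffs_in_contraction t by blast
  have qr: "q * r = [:c ^ k:] * g - t" using eq by simp
  have "q * r \<in> N"
    unfolding qr
    by (intro ideal_diff[OF subring_polys ideal_N] ideal_mult[OF subring_polys ideal_N] const_in_polys subring_power[OF A cA] g(1) tN)
  then have qN: "q \<in> N" using prime_N[OF q rB] rN by blast
  have gB: "g \<in> poly_set A" using ideal_subset[OF subring_polys ideal_N] g by blast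
  \<comment> \<open>Modulo \<open>P\<close>, the product is \<open>g\<close> scaled by
    \<open>c ^ k\<close>, which is outside \<open>P\<close>; the degree stays
    \<open>n\<close>.\<close>
  have lead_qr: "lead_mod P (q * r) n"
    unfolding lead_mod_def
  proof (intro conjI allI impI notI)
    assume "poly.coeff (q * r) n \<in> P"
    then have "poly.coeff (q * r) n + poly.coeff t n \<in> P"
      using ideal_add[OF A ideal_contraction] t by blast
    then have "c ^ k * poly.coeff g n \<in> P" by (simp add: qr)
    then show False
      using prime_contraction cP[of k] subring_power[OF A cA, of k] g(2) gB
      unfolding prime_set_def lead_mod_def poly_set_def by blast
  next
    fix i assume "n < i"
    then have "poly.coeff g i \<in> P" using g(2) by (simp add: lead_mod_def)
    then have "c ^ k * poly.coeff g i - poly.coeff t i \<in> P"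
      by (intro ideal_diff[OF A ideal_contraction] ideal_mult[OF A ideal_contraction] subring_power[OF A cA] t)
    then show "poly.coeff (q * r) i \<in> P" by (simp add: qr)
  qed
  have "\<exists>j. poly.coeff q j \<notin> P"
  proof (rule ccontr)
    assume "\<nexists>j. poly.coeff q j \<notin> P"
    then have "poly.coeff (q * r) n \<in> P"
      unfolding coeff_mult using rB
      by (intro ideal_sum[OF A ideal_contraction] ideal_mult_right[OF A ideal_contraction]) (auto simp: poly_set_def)
    then show False using lead_qr by (simp add: lead_mod_def)
  qed
  then obtain i where i: "lead_mod P q i"
    using lead_mod_exists[OF ideal_zero[OF A ideal_contraction]] by blast
  have "i + m = n"
    using lead_mod_unique[OF lead_mod_mult[OF A prime_contraction q i rB r] lead_qr] .
  moreover have "n \<le> i" using min[OF qN i] .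
  ultimately have m0: "m = 0" by simp
  obtain e where e: "e \<in> poly_set A" "r - h * e \<in> N" using rJ by blast
  have "poly.coeff (r - [:c:]) i \<in> P" for i
    using r ideal_zero[OF A ideal_contraction] by (cases i) (auto simp: m0 c_def lead_mod_def)
  then have "r - [:c:] \<in> N" by (rule coeffs_in_contraction)
  then have "(r - h * e) - (r - [:c:]) \<in> N" by (rule ideal_diff[OF subring_polys ideal_N e(2)])
  then have "[:c:] - h * e \<in> N" by (simp add: algebra_simps)
  then show thesis using that e(1) cA cP[of 1] by simp
qed

text \<open>Reducing \<open>b\<^sup>k \<equiv> d v\<close> modulo \<open>g\<close> leaves a remainder of degree below \<open>n\<close>, so the resulting
  congruence modulo \<open>N\<close> holds coefficientwise modulo \<open>P\<close>; this makes \<open>P\<close> Goldman, with witness \<open>a b\<close>.\<close>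

lemma maximal_of_goldman:
  assumes H: "hilbert_set A" and G: "goldman_set (poly_set A) N f"
  shows "maximal_set (poly_set A) N"
proof -
  have f: "f \<in> poly_set A - N" using G by (simp add: goldman_set_def)
  obtain g0 n0 where g0: "g0 \<in> N" "lead_mod P g0 n0"
    using goldman_contains_nonzero_mod[OF G] .
  define n where "n = (LEAST n. \<exists>g\<in>N. lead_mod P g n)"
  have "\<exists>g\<in>N. lead_mod P g n"
    unfolding n_def by (rule LeastI[of _ n0]) (use g0 in blast)
  then obtain g where g: "g \<in> N" "lead_mod P g n" by blast
  have min: "n \<le> n'" if "g' \<in> N" "lead_mod P g' n'" for g' n'
    unfolding n_def using that by (intro Least_le) blast
  have gB: "g \<in> poly_set A" using ideal_subset[OF subring_polys ideal_N] g by blast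
  define a where "a = poly.coeff g n"
  have aA: "a \<in> A" and aP: "a \<notin> P" using gB g by (auto simp: a_def poly_set_def lead_mod_def)
  \<comment> \<open>In degree 0 the polynomial \<open>g\<close> would be constant modulo
    \<open>P\<close>, forcing \<open>a\<close> into \<open>P\<close>. Positivity is used later,
    where a constant must have no coefficient in degrees from \<open>n\<close> on.\<close>
  have n0: "n > 0"
  proof (rule ccontr)
    assume "\<not> n > 0"
    then have "poly.coeff (g - [:a:]) i \<in> P" for i
      using g ideal_zero[OF A ideal_contraction] by (cases i) (auto simp: a_def lead_mod_def)
    then have "g - [:a:] \<in> N" by (rule coeffs_in_contraction)
    then have "g - (g - [:a:]) \<in> N" by (rule ideal_diff[OF subring_polys ideal_N g(1)])
    then show False using aP aA by (simp add: P_def)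
  qed
  obtain e b where e: "e \<in> poly_set A" and b: "b \<in> A - P" and eb: "[:b:] - f * e \<in> N"
    using divides_const_mod[OF g min f] .
  have ab: "a * b \<in> A - P"
    using prime_contraction aA aP b subring_mult[OF A] unfolding prime_set_def by blast
  have "\<exists>y\<in>A. \<exists>k. (a * b) ^ k - d * y \<in> P" if d: "d \<in> A - P" for d
  proof -
    have "[:d:] \<in> poly_set A - N" using d const_in_polys by (auto simp: P_def)
    then obtain u k where u: "u \<in> poly_set A" "f ^ k - [:d:] * u \<in> N"
      using G unfolding goldman_set_def by blast
    \<comment> \<open>Modulo \<open>N\<close>, \<open>b ^ k\<close> is \<open>(f * e) ^ k\<close>
      and \<open>f ^ k\<close> is \<open>d * u\<close>, so \<open>b ^ k\<close> is
      \<open>d * v\<close>.\<close>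
    define v where "v = u * e ^ k"
    have vB: "v \<in> poly_set A"
      unfolding v_def by (intro subring_mult[OF subring_polys] subring_power[OF subring_polys] u e)
    have pow: "[:b:] ^ j - (f * e) ^ j \<in> N" for j
    proof (induction j)
      case 0
      then show ?case using ideal_zero[OF subring_polys ideal_N] by simp
    next
      case (Suc j)
      have "[:b:] * ([:b:] ^ j - (f * e) ^ j) + (f * e) ^ j * ([:b:] - f * e) \<in> N"
        using b f by (intro ideal_add[OF subring_polys ideal_N] ideal_mult[OF subring_polys ideal_N] Suc.IH eb const_in_polys
            subring_power[OF subring_polys] subring_mult[OF subring_polys] e) auto
      also have "[:b:] * ([:b:] ^ j - (f * e) ^ j) + (f * e) ^ j * ([:b:] - f * e)
          = [:b:] ^ Suc j - (f * e) ^ Suc j"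
        unfolding power_Suc right_diff_distrib by (simp only: mult.commute) simp
      finally show ?case .
    qed
    have "([:b:] ^ k - (f * e) ^ k) + e ^ k * (f ^ k - [:d:] * u) \<in> N"
      by (intro ideal_add[OF subring_polys ideal_N] ideal_mult[OF subring_polys ideal_N] pow u subring_power[OF subring_polys] e)
    also have "([:b:] ^ k - (f * e) ^ k) + e ^ k * (f ^ k - [:d:] * u) = [:b ^ k:] - [:d:] * v"
      unfolding power_mult_distrib right_diff_distrib v_def poly_const_pow
      by (simp only: mult_ac) (simp add: algebra_simps)
    finally have bv: "[:b ^ k:] - [:d:] * v \<in> N" .
    obtain j q r where qr: "q \<in> poly_set A" "r \<in> poly_set A" "\<And>i. i \<ge> n \<Longrightarrow> poly.coeff r i \<in> P"
      "[:a ^ j:] * v = q * g + r"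
      using pseudo_division_mod[OF A ideal_contraction gB, of n v] g(2) vB unfolding a_def lead_mod_def by metis
    have dA: "d \<in> A" and bA: "b \<in> A" using d b by auto
    have "[:a ^ j:] * ([:b ^ k:] - [:d:] * v) + [:d:] * (q * g) \<in> N"
      by (intro ideal_add[OF subring_polys ideal_N] ideal_mult[OF subring_polys ideal_N] bv const_in_polys subring_power[OF A] aA dA qr g)
    also have "[:a ^ j:] * ([:b ^ k:] - [:d:] * v) + [:d:] * (q * g)
        = [:a ^ j * b ^ k:] - [:d:] * ([:a ^ j:] * v - q * g)"
      by (simp add: algebra_simps smult_diff_right)
    finally have w: "[:a ^ j * b ^ k:] - [:d:] * r \<in> N"
      using qr(4) by simp
    have "a ^ j * b ^ k - d * poly.coeff r 0 \<in> P"
    proof (rule ccontr)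
      assume "\<not> ?thesis"
      then have "poly.coeff ([:a ^ j * b ^ k:] - [:d:] * r) 0 \<notin> P" by simp
      then obtain i where i: "lead_mod P ([:a ^ j * b ^ k:] - [:d:] * r) i"
        using lead_mod_exists[OF ideal_zero[OF A ideal_contraction]] by blast
      \<comment> \<open>From degree \<open>n\<close> on only \<open>r\<close> contributes, and its
        coefficients there lie in \<open>P\<close>. So this element of \<open>N\<close> cannot have
        a degree modulo \<open>P\<close>.\<close>
      then have ni: "n \<le> i" using min[OF w] by blast
      then have "poly.coeff ([:a ^ j * b ^ k:] - [:d:] * r) i = - (d * poly.coeff r i)"
        using n0 by (cases i) auto
      moreover have "- (d * poly.coeff r i) \<in> P"
        by (intro ideal_uminus[OF A ideal_contraction] ideal_mult[OF A ideal_contraction] qr(3) ni dA)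
      ultimately show False using i by (simp add: lead_mod_def)
    qed
    \<comment> \<open>The extra factor equalizes the exponents, giving a power of the single witness
      \<open>a * b\<close>.\<close>
    then have "(a ^ k * b ^ j) * (a ^ j * b ^ k - d * poly.coeff r 0) \<in> P"
      by (intro ideal_mult[OF A ideal_contraction] subring_mult[OF A] subring_power[OF A] aA bA)
    then have "(a * b) ^ (j + k) - d * (a ^ k * b ^ j * poly.coeff r 0) \<in> P"
      by (simp add: algebra_simps power_add power_mult_distrib)
    moreover have "a ^ k * b ^ j * poly.coeff r 0 \<in> A"
      using qr(2) by (intro subring_mult[OF A] subring_power[OF A] aA bA) (simp add: poly_set_def)
    ultimately show ?thesis by blast
  qed
  then have "goldman_set A P (a * b)"
    using prime_contraction ab unfolding goldman_set_def by blast
  then have mx: "maximal_set A P" using hilbert_setD[OF H] by blast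
  \<comment> \<open>Modulo \<open>N\<close>, \<open>h\<close> divides a constant \<open>b\<close>
    outside \<open>P\<close>, and \<open>b\<close> is a unit modulo the maximal ideal
    \<open>P\<close>; hence \<open>h\<close> is a unit modulo \<open>N\<close>.\<close>
  have "\<exists>y\<in>poly_set A. 1 - h * y \<in> N" if h: "h \<in> poly_set A - N" for h
  proof -
    obtain e b where e: "e \<in> poly_set A" and b: "b \<in> A - P" and eb: "[:b:] - h * e \<in> N"
      using divides_const_mod[OF g min h] .
    obtain y where y: "y \<in> A" "1 - b * y \<in> P"
      using mx b unfolding maximal_set_def by blast
    have "[:1 - b * y:] + [:y:] * ([:b:] - h * e) \<in> N"
      using y by (intro ideal_add[OF subring_polys ideal_N] ideal_mult[OF subring_polys ideal_N] const_in_polys eb) (auto simp: P_def)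
    also have "[:1 - b * y:] + [:y:] * ([:b:] - h * e) = 1 - h * (e * [:y:])"
      by (simp add: algebra_simps smult_diff_right one_pCons)
    finally show ?thesis
      using subring_mult[OF subring_polys e const_in_polys[OF y(1)]] by blast
  qed
  then show ?thesis
    using N unfolding maximal_set_def prime_set_def by blast
qed

end


lemma hilbert_set_poly_set:
  assumes "subring_set A" "hilbert_set A"
  shows "hilbert_set (poly_set A)"
  unfolding hilbert_set_def
  using maximal_of_goldman[OF assms(1) _ refl assms(2)] by (auto simp: goldman_set_def)


section \<open>The localization and the ring \<open>R\<close> inside the polynomials over the
  fraction field\<close>

lemma subring_localization:
  fixes S :: "'a::idom set"
  assumes "S \<noteq> {}" "0 \<notin> S" "\<And>s t. s \<in> S \<Longrightarrow> t \<in> S \<Longrightarrow> s * t \<in> S"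
  shows "subring_set (carrier (localization S))" "range to_fract \<subseteq> carrier (localization S)"
proof -
  obtain s where s: "s \<in> S" using assms(1) by blast
  have nz: "t \<noteq> 0" if "t \<in> S" for t using that assms(2) by auto
  show "range to_fract \<subseteq> carrier (localization S)"
  proof
    fix x assume "x \<in> range (to_fract :: 'a \<Rightarrow> _)"
    then obtain d where "x = Fract d 1" by (auto simp: to_fract_def)
    \<comment> \<open>\<open>S\<close> is not assumed to contain 1, so a denominator is borrowed
      from any of its elements.\<close>
    also have "\<dots> = Fract (d * s) s" using nz[OF s] by (simp add: eq_fract)
    finally show "x \<in> carrier (localization S)" using s by (auto simp: localization_def)
  qed
  then have one: "1 \<in> carrier (localization S)"
    using to_fract_1 by (metis rangeI subsetD)
  show "subring_set (carrier (localization S))"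
    unfolding subring_set_def
  proof (intro conjI ballI one)
    fix x y assume "x \<in> carrier (localization S)" "y \<in> carrier (localization S)"
    then obtain a s b t where xy: "x = Fract a s" "y = Fract b t" "s \<in> S" "t \<in> S"
      by (auto simp: localization_def)
    then have "x - y = Fract (a * t - b * s) (s * t)" "x * y = Fract (a * b) (s * t)"
      using nz by simp_all
    then show "x - y \<in> carrier (localization S)" "x * y \<in> carrier (localization S)"
      using assms(3)[OF xy(3,4)] by (auto simp: localization_def)
  qed
qed

lemma hom_to_fract: "hom_set UNIV (to_fract :: 'a::idom \<Rightarrow> _)"
  by (simp add: hom_set_def)

theorem theorem2p12:
  fixes S :: "'a::idom set"
  defines "D \<equiv> (ring_of_type_algebra :: 'a ring)"
  assumes "S \<noteq> {}" and "0 \<notin> S" and "\<And>s t. s \<in> S \<Longrightarrow> t \<in> S \<Longrightarrow> s * t \<in> S"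
    and "\<And>P Q. primeideal P D \<Longrightarrow> P \<inter> S \<noteq> {} \<Longrightarrow>
           primeideal Q D \<Longrightarrow> Q \<noteq> {0} \<Longrightarrow> Q \<subseteq> P \<Longrightarrow> Q \<inter> S \<noteq> {}"
  shows "hilbert_domain (D_plus_X_localization_poly S) \<longleftrightarrow>
         hilbert_domain D \<and> hilbert_domain (localization S)"
proof -
  define L where "L = carrier (localization S)"
  define R where "R = carrier (D_plus_X_localization_poly S)"
  note L = subring_localization(1)[OF assms(2-4), folded L_def]
  note DL = subring_localization(2)[OF assms(2-4), folded L_def]
  have R_iff: "p \<in> R \<longleftrightarrow> poly.coeff p 0 \<in> range to_fract \<and> (\<forall>i\<ge>1. poly.coeff p i \<in> L)" for p
    by (simp add: R_def D_plus_X_localization_poly_def L_def)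
  have D: "subring_set (UNIV :: 'a set)" by (simp add: subring_set_def)
  note B = subring_poly_set[OF L]
  have RB: "R \<subseteq> poly_set L"
  proof
    fix p assume "p \<in> R"
    then have "poly.coeff p i \<in> L" for i
      using DL by (cases "i = 0") (auto simp: R_iff)
    then show "p \<in> poly_set L" by (simp add: poly_set_def)
  qed
  have R_alt: "R = {p \<in> poly_set L. poly.coeff p 0 \<in> range to_fract}"
    using RB by (auto simp: R_iff poly_set_def)
  have fract: "subring_set (range (to_fract :: 'a \<Rightarrow> _))"
    by (rule subring_image[OF D hom_to_fract])
  have R: "subring_set R"
    using subring_one[OF B] subring_diff[OF B] subring_mult[OF B]
      subring_one[OF fract] subring_diff[OF fract] subring_mult[OF fract]
    unfolding subring_set_def R_alt by (simp add: mult_poly_0_left coeff_mult_0)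
  have rings: "D = ring_on UNIV" "localization S = ring_on L" "D_plus_X_localization_poly S = ring_on R"
    by (simp_all add: D_def ring_on_def L_def R_def localization_def D_plus_X_localization_poly_def
        ring_of_type_algebra_def)
  \<comment> \<open>Evaluation at 0, with its value pulled back from the fraction field to
    \<open>D\<close>. It is meaningful only on \<open>R\<close>, which is why \<open>hom_set\<close>
    constrains sums and products only on the given subring.\<close>
  define h where "h = (\<lambda>p. inv_into UNIV to_fract (poly.coeff p 0) :: 'a)"
  have h_eq: "to_fract (h p) = poly.coeff p 0" if "p \<in> R" for p
    using that by (simp add: h_def R_iff f_inv_into_f)
  have hom_h: "hom_set R h"
    unfolding hom_set_def
  proof (intro conjI ballI)
    have "to_fract (h 1) = to_fract 1"
      using h_eq[OF subring_one[OF R]] by simp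
    then show "h 1 = 1" by (simp only: to_fract_eq_iff)
    fix p q assume pq: "p \<in> R" "q \<in> R"
    have "to_fract (h (p + q)) = to_fract (h p + h q)"
      using h_eq subring_add[OF R] pq by simp
    then show "h (p + q) = h p + h q" by (simp only: to_fract_eq_iff)
    have "to_fract (h (p * q)) = to_fract (h p * h q)"
      using h_eq subring_mult[OF R] pq by (simp add: coeff_mult_0)
    then show "h (p * q) = h p * h q" by (simp only: to_fract_eq_iff)
  qed
  have const_R: "[:to_fract d:] \<in> R" for d
    using subring_zero[OF L] by (simp add: R_iff coeff_pCons split: nat.split)
  have "h [:to_fract d:] = d" for d
    using h_eq[OF const_R[of d]] by simp
  then have h_image: "h ` R = UNIV"
    using const_R by (metis UNIV_eq_I imageI)
  have coeffs: "poly p 1 \<in> L" if "p \<in> R" for p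
    using that RB by (auto simp: poly_altdef poly_set_def intro!: subring_sum[OF L])
  \<comment> \<open>Every \<open>a\<close> in \<open>L\<close> is the value at 1 of
    \<open>a X\<close>, which lies in \<open>R\<close> as its constant term is 0.\<close>
  moreover have "a \<in> (\<lambda>p. poly p 1) ` R" if "a \<in> L" for a
    using that subring_zero[OF L] to_fract_0
    by (intro image_eqI[of _ _ "monom a 1"]) (auto simp: R_iff poly_monom)
  ultimately have eval_image: "(\<lambda>p. poly p 1) ` R = L" by blast
  have eval_hom: "hom_set R (\<lambda>p. poly p 1)" by (simp add: hom_set_def)
  \<comment> \<open>This is the ideal \<open>X L[X]\<close> shared by \<open>R\<close> and
    \<open>L[X]\<close>; on \<open>R\<close> it is the kernel of \<open>h\<close>.\<close>
  define I where "I = {p \<in> poly_set L. poly.coeff p 0 = 0}"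
  have I: "ideal_set (poly_set L) I"
    using subring_zero[OF B] subring_add[OF B] subring_mult[OF B]
    by (auto simp: ideal_set_def I_def coeff_mult_0)
  have IR: "I \<subseteq> R"
    using to_fract_0 by (auto simp: I_def R_alt)
  have ker: "p \<in> I" if "p \<in> R" "h p = 0" for p
    using h_eq[OF that(1)] that RB by (auto simp: I_def)
  have "hilbert_set R \<longleftrightarrow> hilbert_set (UNIV :: 'a set) \<and> hilbert_set L"
    using hilbert_set_image[OF R hom_h] hilbert_set_image[OF R eval_hom]
      hilbert_set_common_ideal[OF R B RB I IR hilbert_set_poly_set[OF L] hom_h ker]
    unfolding h_image eval_image by blast
  then show ?thesis
    unfolding rings using hilbert_domain_ring_on D L R by metis
qed

end
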